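(* Let $A = (a_{ij})$ be an $n \times n$ matrix with integer entries, and let $\vec{m} = (m_1, \dots, m_n)$ be an integer vector with $m_i > 1$ for all $i$. If the $m_i$ are pairwise relatively prime and for each row $i$ at least one matrix element $a_{ij}$ of that row is relatively prime to $m_i$, then the system $A\vec{x} = \vec{b} \mod \vec{m}$ has solutions for all integer vectors $\vec{b}$. There is a solution $\vec{x}$ in an $n$-dimensional parallelepiped $\mathcal{X} = \mathbb{Z}_M^n/L$ of volume $M = m_1 \cdots m_n$, where $L$ is a lattice in $\mathbb{Z}_M^n$.
   Context: For an integer $n\times n$ matrix $A=(a_{ij})$ and integer vectors $\vec{b}=(b_1,\dots,b_n)$, $\vec{m}=(m_1,\dots,m_n)$, the notation $A\vec{x} = \vec{b} \mod \vec{m}$ means the system of congruences $a_{i1}x_1 + \cdots + a_{in}x_n \equiv b_i \pmod{m_i}$, $i=1,\dots,n$, in the unknown integer vector $\vec{x}=(x_1,\dots,x_n)$; the moduli may differ from row to row. $\mathbb{Z}_M = \mathbb{Z}/M\mathbb{Z}$, and a lattice in $\mathbb{Z}_M^n$ is a subgroup of $\mathbb{Z}_M^n$. The quotient $\mathbb{Z}_M^n/L$ is regarded as a discrete parallelepiped: it is identified with the integer points of a parallelepiped spanned by $n$ vectors generating the preimage of $L$ in $\mathbb{Z}^n$. Its volume is the number of its elements (lattice points). *)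

theory Defs
  imports
    "HOL-Analysis.Analysis"
    "HOL-Algebra.Product_Groups"
    "HOL-Number_Theory.Cong"
begin

text \<open>Vectors are indexed by a finite type \<open>'n\<close>, with \<open>n = CARD('n)\<close>.  The modulus
  may differ from row to row.\<close>

definition solves_mod :: "int ^ 'n ^ 'n \<Rightarrow> int ^ 'n \<Rightarrow> int ^ 'n \<Rightarrow> int ^ 'n \<Rightarrow> bool" where
  "solves_mod A b m x \<longleftrightarrow> (\<forall>i. [(A *v x) $ i = b $ i] (mod m $ i))"

definition Zmod_vec :: "nat \<Rightarrow> ('n \<Rightarrow> int) monoid" where
  "Zmod_vec M = product_group (UNIV :: 'n set) (\<lambda>_. integer_mod_group M)"

definition reduce_vec :: "nat \<Rightarrow> int ^ 'n \<Rightarrow> ('n \<Rightarrow> int)" where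
  "reduce_vec M x = (\<lambda>i. x $ i mod int M)"

definition coset_class :: "nat \<Rightarrow> ('n \<Rightarrow> int) set \<Rightarrow> int ^ 'n \<Rightarrow> ('n \<Rightarrow> int) set" where
  "coset_class M L x = L #>\<^bsub>Zmod_vec M\<^esub> reduce_vec M x"

text \<open>The \<open>n\<close> vectors \<open>v j\<close> generate the preimage of \<open>L\<close> in the group of integer vectors.
  For \<open>M > 0\<close> that preimage contains all multiples of \<open>M\<close>, hence has rank \<open>n\<close>, so such
  vectors are automatically linearly independent.\<close>

definition generates_preimage ::
    "nat \<Rightarrow> ('n \<Rightarrow> int) set \<Rightarrow> ('n \<Rightarrow> int ^ 'n) \<Rightarrow> bool" where
  "generates_preimage M L v \<longleftrightarrow>
     range (\<lambda>c :: 'n \<Rightarrow> int. \<Sum>j\<in>UNIV. c j *s v j) = {x. reduce_vec M x \<in> L}"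

definition int_vec_to_real :: "int ^ 'n \<Rightarrow> real ^ 'n" where
  "int_vec_to_real x = (\<chi> i. real_of_int (x $ i))"

text \<open>Half-open, so that the translates by the lattice spanned by linearly independent
  \<open>w j\<close> tile the space.\<close>

definition parallelepiped :: "('n \<Rightarrow> real ^ 'n) \<Rightarrow> (real ^ 'n) set" where
  "parallelepiped w = {\<Sum>j\<in>UNIV. t j *\<^sub>R w j |t. \<forall>j. 0 \<le> t j \<and> t j < 1}"

definition discrete_parallelepiped :: "('n \<Rightarrow> int ^ 'n) \<Rightarrow> (int ^ 'n) set" where
  "discrete_parallelepiped v =
     {x. int_vec_to_real x \<in> parallelepiped (\<lambda>j. int_vec_to_real (v j))}"

end

theory Submission
  imports Defs
begin

text \<open>A row \<open>i\<close> with an entry coprime to \<open>m $ i\<close> can be solved on its own, and the Chinese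
  remainder theorem, applied to each coordinate, glues the row solutions together. Hence \<open>A\<close> induces
  a surjective homomorphism from \<open>\<int>\<^sub>M\<^sup>n\<close> onto the product of the \<open>\<int>/m\<^sub>i\<close>; its kernel
  is \<open>L\<close>, and the first isomorphism theorem gives the index \<open>M\<close>. The preimage of \<open>L\<close> in
  \<open>\<int>\<^sup>n\<close> contains \<open>M\<int>\<^sup>n\<close>, so any \<open>n\<close> generators form a real basis; taking
  integer parts of the coordinates in this basis shows that the half-open parallelepiped is a
  system of representatives of the cosets.\<close>

section \<open>Solvability by the Chinese remainder theorem\<close>

lemma chinese_remainder_int:
  fixes m u :: "'a \<Rightarrow> int"
  assumes "finite S" "\<And>i j. i \<in> S \<Longrightarrow> j \<in> S \<Longrightarrow> i \<noteq> j \<Longrightarrow> coprime (m i) (m j)"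
  shows "\<exists>x. \<forall>i\<in>S. [x = u i] (mod m i)"
  using assms
proof (induction S rule: finite_induct)
  case (insert k S)
  then obtain x where x: "\<forall>i\<in>S. [x = u i] (mod m i)"
    by blast
  have "coprime (m k) (\<Prod>i\<in>S. m i)"
    using insert by (intro prod_coprime_right) auto
  then obtain y where "[y = u k] (mod m k)" and y: "[y = x] (mod (\<Prod>i\<in>S. m i))"
    using binary_chinese_remainder_int by blast
  moreover have "[y = u i] (mod m i)" if "i \<in> S" for i
    using x that cong_dvd_modulus[OF y] insert.hyps(1) by (meson cong_trans dvd_prodI)
  ultimately show ?case by blast
qed simp

text \<open>Row \<open>i\<close> is solved by its pivot column \<open>p i\<close> alone: that
  unknown is \<open>b $ i\<close> times an inverse of the pivot, and all others vanish modulo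
  \<open>m $ i\<close>. These demands on a fixed unknown \<open>x $ j\<close> concern pairwise
  coprime moduli, so they are compatible.\<close>

lemma solves_mod_exists:
  fixes A :: "int ^ 'n ^ 'n" and m b :: "int ^ 'n"
  assumes "\<And>i j. i \<noteq> j \<Longrightarrow> coprime (m $ i) (m $ j)"
    and "\<And>i. \<exists>j. coprime (A $ i $ j) (m $ i)"
  shows "\<exists>x. solves_mod A b m x"
proof -
  obtain p where p: "\<And>i. coprime (A $ i $ p i) (m $ i)"
    using assms(2) by metis
  then have "\<exists>a. [A $ i $ p i * a = 1] (mod m $ i)" for i
    using cong_solve_coprime_int by blast
  then obtain a where a: "\<And>i. [A $ i $ p i * a i = 1] (mod m $ i)"
    by metis
  \<comment> \<open>One application per column \<open>j\<close>. The same column may be the pivot of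
    several rows, or of none.\<close>
  have "\<exists>z. \<forall>i\<in>UNIV. [z = (if j = p i then a i * b $ i else 0)] (mod m $ i)" for j
    using assms(1) by (intro chinese_remainder_int) auto
  then obtain z where z: "\<And>i j. [z j = (if j = p i then a i * b $ i else 0)] (mod m $ i)"
    by (metis UNIV_I)
  have "[(\<Sum>j\<in>UNIV. A $ i $ j * z j) = b $ i] (mod m $ i)" for i
  proof -
    have "[(\<Sum>j\<in>UNIV. A $ i $ j * z j) =
        (\<Sum>j\<in>UNIV. A $ i $ j * (if j = p i then a i * b $ i else 0))] (mod m $ i)"
      by (intro cong_sum cong_mult cong_refl z)
    also have "(\<Sum>j\<in>UNIV. A $ i $ j * (if j = p i then a i * b $ i else 0)) =
        (A $ i $ p i * a i) * b $ i"
      by (simp add: if_distrib cong: if_cong)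
    also have "[\<dots> = b $ i] (mod m $ i)"
      using cong_mult[OF a cong_refl] by (metis mult_1)
    finally show ?thesis .
  qed
  then have "solves_mod A b m (\<chi> j. z j)"
    by (simp add: solves_mod_def matrix_vector_mult_def)
  then show ?thesis by blast
qed

section \<open>Generators of subgroups of the integer vectors\<close>

lemma int_subgroup_scale_closed:
  fixes H :: "(int ^ 'n) set"
  assumes "0 \<in> H" "\<And>x y. x \<in> H \<Longrightarrow> y \<in> H \<Longrightarrow> x - y \<in> H" "x \<in> H"
  shows "c *s x \<in> H"
proof (induction c rule: int_induct[where k = 0])
  case base
  then show ?case using assms by simp
next
  case (step1 c)
  have "(c + 1) *s x = c *s x - (0 - x)"
    by (simp add: vec_eq_iff algebra_simps)
  then show ?case using step1 assms by metis
next
  case (step2 c)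
  have "(c - 1) *s x = c *s x - x"
    by (simp add: vec_eq_iff algebra_simps)
  then show ?case using step2 assms by metis
qed

text \<open>\<open>S\<close> serves both as the set of coordinates that may be nonzero and as the
  index set of the generators. Adding a coordinate \<open>k\<close>, the induction hypothesis
  handles the vectors of \<open>H\<close> that vanish at \<open>k\<close>; one further vector
  \<open>w\<close>, whose \<open>k\<close>-th coordinate generates the ideal of all
  \<open>k\<close>-th coordinates, yields the rest. Generators may be zero, so nothing is said about
  the rank.\<close>

lemma int_subgroup_basis:
  fixes H :: "(int ^ 'n) set"
  assumes "finite S"
    and "0 \<in> H" "\<And>x y. x \<in> H \<Longrightarrow> y \<in> H \<Longrightarrow> x - y \<in> H"
    and "\<And>x i. x \<in> H \<Longrightarrow> i \<notin> S \<Longrightarrow> x $ i = 0"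
  shows "\<exists>v. H = range (\<lambda>c :: 'n \<Rightarrow> int. \<Sum>j\<in>S. c j *s v j)"
  using assms
proof (induction S arbitrary: H rule: finite_induct)
  case empty
  then have "H = {0}" by (auto simp: vec_eq_iff)
  then show ?case by auto
next
  case (insert k S)
  have scale: "c *s x \<in> H" if "x \<in> H" for c x
    using int_subgroup_scale_closed[OF insert.prems(1,2)] that by blast
  have "\<exists>v. {x \<in> H. x $ k = 0} = range (\<lambda>c :: 'n \<Rightarrow> int. \<Sum>j\<in>S. c j *s v j)"
    by (intro insert.IH) (use insert.prems in \<open>auto, metis insert_iff\<close>)
  then obtain v where v: "{x \<in> H. x $ k = 0} = range (\<lambda>c :: 'n \<Rightarrow> int. \<Sum>j\<in>S. c j *s v j)"
    by blast
  have "\<exists>w\<in>H. \<forall>x\<in>H. w $ k dvd x $ k"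
  proof (cases "\<exists>w\<in>H. w $ k > 0")
    case False
    \<comment> \<open>\<open>H\<close> is closed under negation, so without positive
      \<open>k\<close>-th coordinates there are no negative ones either, and \<open>0\<close> can
      serve as \<open>w\<close>.\<close>
    have "x $ k = 0" if "x \<in> H" for x
    proof -
      have "\<not> x $ k > 0" "\<not> (0 - x) $ k > 0"
        using False that insert.prems(2)[OF insert.prems(1) that] by blast+
      then show ?thesis by simp
    qed
    then show ?thesis using insert.prems(1) by force
  next
    case True
    then obtain w where w: "w \<in> H" "w $ k > 0"
      and min: "\<And>y. y \<in> H \<and> y $ k > 0 \<Longrightarrow> nat (w $ k) \<le> nat (y $ k)"
      using ex_has_least_nat[of "\<lambda>w. w \<in> H \<and> w $ k > 0" _ "\<lambda>w. nat (w $ k)"] by blast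
    have "w $ k dvd x $ k" if "x \<in> H" for x
    proof -
      \<comment> \<open>Division with remainder inside \<open>H\<close>: a nonzero remainder would
        be a smaller positive \<open>k\<close>-th coordinate than that of \<open>w\<close>.\<close>
      let ?y = "x - (x $ k div w $ k) *s w"
      have "?y \<in> H" by (intro insert.prems scale that w)
      moreover have yk: "?y $ k = x $ k mod w $ k"
        by (simp add: minus_div_mult_eq_mod)
      ultimately have "\<not> x $ k mod w $ k > 0"
        using min[of ?y] pos_mod_bound[OF w(2), of "x $ k"] nat_less_eq_zless[of "x $ k mod w $ k"]
        by (metis less_imp_le not_le)
      then show ?thesis
        using pos_mod_sign[OF w(2), of "x $ k"] by (simp add: dvd_eq_mod_eq_0)
    qed
    then show ?thesis using w by blast
  qed
  then obtain w where w: "w \<in> H" "\<And>x. x \<in> H \<Longrightarrow> w $ k dvd x $ k" by blast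
  have sum_upd: "(\<Sum>j\<in>insert k S. c j *s (v(k := w)) j) = c k *s w + (\<Sum>j\<in>S. c j *s v j)" for c
  proof -
    have "(\<Sum>j\<in>S. c j *s (v(k := w)) j) = (\<Sum>j\<in>S. c j *s v j)"
      using insert.hyps by (intro sum.cong) auto
    then show ?thesis using insert.hyps by simp
  qed
  have "H = range (\<lambda>c. \<Sum>j\<in>insert k S. c j *s (v(k := w)) j)"
  proof (intro equalityI subsetI)
    fix x assume x: "x \<in> H"
    obtain q where q: "x $ k = w $ k * q" using w(2)[OF x] by (auto elim: dvdE)
    have "x - q *s w \<in> {x \<in> H. x $ k = 0}"
      using q insert.prems(2)[OF x scale[OF w(1)]] by simp
    then obtain c where c: "x - q *s w = (\<Sum>j\<in>S. c j *s v j)"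
      unfolding v by blast
    have "(\<Sum>j\<in>S. (c(k := q)) j *s v j) = (\<Sum>j\<in>S. c j *s v j)"
      using insert.hyps by (intro sum.cong) auto
    then have "x = (\<Sum>j\<in>insert k S. (c(k := q)) j *s (v(k := w)) j)"
      using c unfolding sum_upd by (simp add: algebra_simps)
    then show "x \<in> range (\<lambda>c. \<Sum>j\<in>insert k S. c j *s (v(k := w)) j)" by blast
  next
    fix x assume "x \<in> range (\<lambda>c. \<Sum>j\<in>insert k S. c j *s (v(k := w)) j)"
    then obtain c where c: "x = c k *s w + (\<Sum>j\<in>S. c j *s v j)" unfolding sum_upd by blast
    have "(\<Sum>j\<in>S. c j *s v j) \<in> H" using v by blast
    \<comment> \<open>Only closure under differences is assumed, so the sum is written as
      one.\<close>
    then have "c k *s w - (0 - (\<Sum>j\<in>S. c j *s v j)) \<in> H"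
      using scale[OF w(1)] insert.prems(1,2) by blast
    then show "x \<in> H" using c by simp
  qed
  then show ?case by blast
qed

section \<open>Tiling of space by the half-open parallelepiped\<close>

lemma int_vec_to_real_diff: "int_vec_to_real (x - y) = int_vec_to_real x - int_vec_to_real y"
  by (simp add: int_vec_to_real_def vec_eq_iff)

lemma int_vec_to_real_sum:
  "int_vec_to_real (\<Sum>j\<in>S. c j *s v j) = (\<Sum>j\<in>S. real_of_int (c j) *\<^sub>R int_vec_to_real (v j))"
  by (simp add: int_vec_to_real_def vec_eq_iff)

text \<open>The lattice contains \<open>M\<close> times each standard basis vector, so over the
  reals the \<open>v j\<close> span the whole space; a surjective linear endomorphism in finite
  dimension is injective.\<close>

lemma full_rank_lattice_coordinates:
  fixes v :: "'n::finite \<Rightarrow> int ^ 'n"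
  assumes "M > 0" "\<And>x :: int ^ 'n. M *s x \<in> range (\<lambda>c :: 'n \<Rightarrow> int. \<Sum>j\<in>UNIV. c j *s v j)"
  shows "bij (\<lambda>t :: real ^ 'n. \<Sum>j\<in>UNIV. t $ j *\<^sub>R int_vec_to_real (v j))"
proof -
  let ?f = "\<lambda>t :: real ^ 'n. \<Sum>j\<in>UNIV. t $ j *\<^sub>R int_vec_to_real (v j)"
  have lin: "linear ?f"
    by (intro linearI) (simp_all add: scaleR_add_left sum.distrib scaleR_sum_right)
  have ax: "axis i 1 \<in> range ?f" for i
  proof -
    obtain c :: "'n \<Rightarrow> int" where "M *s axis i 1 = (\<Sum>j\<in>UNIV. c j *s v j)"
      using assms(2) by blast
    then have "int_vec_to_real (M *s axis i 1) =
        (\<Sum>j\<in>UNIV. real_of_int (c j) *\<^sub>R int_vec_to_real (v j))"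
      by (simp only: int_vec_to_real_sum)
    moreover have "int_vec_to_real (M *s axis i 1) = real_of_int M *\<^sub>R axis i 1"
      by (simp add: int_vec_to_real_def vec_eq_iff axis_def)
    ultimately have "real_of_int M *\<^sub>R axis i 1 = ?f (\<chi> j. real_of_int (c j))"
      by simp
    then have "?f ((1 / real_of_int M) *\<^sub>R (\<chi> j. real_of_int (c j))) = axis i 1"
      using assms(1) by (simp only: linear_scale[OF lin] flip: \<open>_ = ?f _\<close>) simp
    then show ?thesis by (rule range_eqI[OF sym])
  qed
  have "subspace (range ?f)"
    using linear_subspace_image[OF lin subspace_UNIV] .
  moreover have "(Basis :: (real ^ 'n) set) \<subseteq> range ?f"
    using ax by (auto simp: Basis_vec_def)
  ultimately have "surj ?f"
    using span_minimal[of Basis "range ?f"] by (simp add: top.extremum_unique)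
  then show ?thesis
    using linear_surj_imp_inj[OF lin] by (simp add: bij_def)
qed

text \<open>Coefficients become a vector instead of a function, so that they live in the Euclidean
  space on which the coordinate map is bijective.\<close>

lemma parallelepiped_vec_iff:
  "x \<in> parallelepiped w \<longleftrightarrow>
    (\<exists>t :: real ^ 'n. x = (\<Sum>j\<in>UNIV. t $ j *\<^sub>R w j) \<and> (\<forall>j. 0 \<le> t $ j \<and> t $ j < 1))"
proof
  assume "x \<in> parallelepiped w"
  then obtain t where "x = (\<Sum>j\<in>UNIV. t j *\<^sub>R w j)" "\<forall>j. 0 \<le> t j \<and> t j < 1"
    unfolding parallelepiped_def by blast
  then show "\<exists>t :: real ^ 'n. x = (\<Sum>j\<in>UNIV. t $ j *\<^sub>R w j) \<and> (\<forall>j. 0 \<le> t $ j \<and> t $ j < 1)"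
    by (intro exI[of _ "\<chi> j. t j"]) simp
qed (auto simp: parallelepiped_def)

text \<open>Subtracting the lattice point \<open>s\<close> with the floors of the coordinates of
  \<open>x\<close> leaves the fractional parts, which lie in the half-open unit interval.\<close>

lemma discrete_parallelepiped_covers:
  fixes v :: "'n::finite \<Rightarrow> int ^ 'n"
  assumes "bij (\<lambda>t :: real ^ 'n. \<Sum>j\<in>UNIV. t $ j *\<^sub>R int_vec_to_real (v j))"
  shows "\<exists>y \<in> discrete_parallelepiped v. x - y \<in> range (\<lambda>c :: 'n \<Rightarrow> int. \<Sum>j\<in>UNIV. c j *s v j)"
proof -
  obtain t :: "real ^ 'n" where t: "int_vec_to_real x = (\<Sum>j\<in>UNIV. t $ j *\<^sub>R int_vec_to_real (v j))"
    using surjD[OF bij_is_surj[OF assms], of "int_vec_to_real x"] by blast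
  define s where "s = (\<Sum>j\<in>UNIV. \<lfloor>t $ j\<rfloor> *s v j)"
  have "int_vec_to_real (x - s) = (\<Sum>j\<in>UNIV. frac (t $ j) *\<^sub>R int_vec_to_real (v j))"
    by (simp add: s_def int_vec_to_real_diff int_vec_to_real_sum t frac_def scaleR_diff_left
        sum_subtractf)
  then have "x - s \<in> discrete_parallelepiped v"
    unfolding discrete_parallelepiped_def parallelepiped_def
    by (intro CollectI exI[of _ "\<lambda>j. frac (t $ j)"]) (simp add: frac_lt_1)
  moreover have "x - (x - s) \<in> range (\<lambda>c :: 'n \<Rightarrow> int. \<Sum>j\<in>UNIV. c j *s v j)"
    by (auto simp: s_def)
  ultimately show ?thesis by blast
qed

text \<open>The coordinates of the two points differ by integers, yet by less than 1 in absolute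
  value because the parallelepiped is half-open.\<close>

lemma discrete_parallelepiped_unique:
  fixes v :: "'n::finite \<Rightarrow> int ^ 'n"
  assumes "bij (\<lambda>t :: real ^ 'n. \<Sum>j\<in>UNIV. t $ j *\<^sub>R int_vec_to_real (v j))"
    and "x \<in> discrete_parallelepiped v" "y \<in> discrete_parallelepiped v"
    and "x - y \<in> range (\<lambda>c :: 'n \<Rightarrow> int. \<Sum>j\<in>UNIV. c j *s v j)"
  shows "x = y"
proof -
  let ?f = "\<lambda>t :: real ^ 'n. \<Sum>j\<in>UNIV. t $ j *\<^sub>R int_vec_to_real (v j)"
  obtain t where t: "int_vec_to_real x = ?f t" "\<forall>j. 0 \<le> t $ j \<and> t $ j < 1"
    using assms(2) by (auto simp: discrete_parallelepiped_def parallelepiped_vec_iff)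
  obtain s where s: "int_vec_to_real y = ?f s" "\<forall>j. 0 \<le> s $ j \<and> s $ j < 1"
    using assms(3) by (auto simp: discrete_parallelepiped_def parallelepiped_vec_iff)
  obtain c :: "'n \<Rightarrow> int" where c: "x - y = (\<Sum>j\<in>UNIV. c j *s v j)"
    using assms(4) by blast
  have "?f t = ?f (s + (\<chi> j. real_of_int (c j)))"
    using arg_cong[OF c, of int_vec_to_real] t(1) s(1)
    by (simp add: int_vec_to_real_diff int_vec_to_real_sum scaleR_add_left sum.distrib algebra_simps)
  then have "t = s + (\<chi> j. real_of_int (c j))"
    by (rule injD[OF bij_is_inj[OF assms(1)]])
  then have tsc: "t $ j = s $ j + real_of_int (c j)" for j
    by simp
  have "c j = 0" for j
  proof -
    have "real_of_int (c j) < 1" "real_of_int (c j) > -1"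
      using tsc[of j] t(2)[rule_format, of j] s(2)[rule_format, of j] by linarith+
    then show ?thesis by linarith
  qed
  then show ?thesis using c by simp
qed

section \<open>Integer vectors modulo \<open>M\<close> and cosets of a lattice\<close>

lemma group_Zmod_vec: "group (Zmod_vec M)"
  by (simp add: Zmod_vec_def)

lemma carrier_Zmod_vec: "M > 0 \<Longrightarrow> carrier (Zmod_vec M) = {r. \<forall>i. 0 \<le> r i \<and> r i < int M}"
  by (auto simp: Zmod_vec_def carrier_integer_mod_group)

lemma reduce_vec_in_carrier: "M > 0 \<Longrightarrow> reduce_vec M x \<in> carrier (Zmod_vec M)"
  by (simp add: carrier_Zmod_vec reduce_vec_def)

lemma reduce_vec_surj:
  assumes "M > 0" "r \<in> carrier (Zmod_vec M :: ('n::finite \<Rightarrow> int) monoid)"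
  shows "reduce_vec M (\<chi> j. r j) = r"
  using assms by (auto simp: carrier_Zmod_vec reduce_vec_def)

lemma reduce_vec_add:
  "reduce_vec M (x + y) = reduce_vec M x \<otimes>\<^bsub>Zmod_vec M\<^esub> reduce_vec M y"
  by (simp add: reduce_vec_def Zmod_vec_def mod_add_eq restrict_UNIV)

lemma reduce_vec_zero: "reduce_vec M 0 = \<one>\<^bsub>Zmod_vec M\<^esub>"
  by (simp add: reduce_vec_def Zmod_vec_def restrict_UNIV)

lemma reduce_vec_diff:
  assumes "M > 0"
  shows "reduce_vec M (x - y) = reduce_vec M x \<otimes>\<^bsub>Zmod_vec M\<^esub> inv\<^bsub>Zmod_vec M\<^esub> reduce_vec M y"
proof -
  interpret group "Zmod_vec M :: ('a \<Rightarrow> int) monoid" by (rule group_Zmod_vec)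
  have "reduce_vec M (x - y) \<otimes>\<^bsub>Zmod_vec M\<^esub> reduce_vec M y = reduce_vec M x"
    by (simp flip: reduce_vec_add)
  then show ?thesis
    using reduce_vec_in_carrier[OF assms] by (metis inv_solve_right)
qed

lemma coset_class_eq_iff:
  assumes "M > 0" "subgroup L (Zmod_vec M)"
  shows "coset_class M L x = coset_class M L y \<longleftrightarrow> reduce_vec M (x - y) \<in> L"
proof -
  interpret group "Zmod_vec M :: ('a \<Rightarrow> int) monoid" by (rule group_Zmod_vec)
  note rc = reduce_vec_in_carrier[OF assms(1)]
  have "coset_class M L x = coset_class M L y \<longleftrightarrow>
      reduce_vec M x \<in> L #>\<^bsub>Zmod_vec M\<^esub> reduce_vec M y"
    unfolding coset_class_def using rcos_self[OF rc assms(2)] repr_independence[OF _ rc assms(2)]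
    by metis
  also have "\<dots> \<longleftrightarrow> reduce_vec M (x - y) \<in> L"
    using subgroup.rcos_module[OF assms(2) group_Zmod_vec rc rc] reduce_vec_diff[OF assms(1)]
    by metis
  finally show ?thesis .
qed

lemma coset_class_surj:
  fixes L :: "('n::finite \<Rightarrow> int) set"
  assumes "M > 0"
  shows "range (coset_class M L) = carrier (Zmod_vec M Mod L)"
proof -
  have "range (reduce_vec M) = carrier (Zmod_vec M :: ('n \<Rightarrow> int) monoid)"
    using reduce_vec_in_carrier[OF assms] reduce_vec_surj[OF assms]
    by (metis (no_types, lifting) image_subset_iff rangeI subsetI subset_antisym)
  moreover have "range (coset_class M L) = (\<lambda>r. L #>\<^bsub>Zmod_vec M\<^esub> r) ` range (reduce_vec M)"
    by (simp add: coset_class_def image_image)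
  ultimately show ?thesis
    by (auto simp: FactGroup_def RCOSETS_def)
qed

text \<open>The preimage of \<open>L\<close> is a subgroup of the integer vectors, so
  \<open>int_subgroup_basis\<close> applies with all coordinates allowed to be nonzero.\<close>

lemma generates_preimage_exists:
  fixes L :: "('n::finite \<Rightarrow> int) set"
  assumes "M > 0" "subgroup L (Zmod_vec M)"
  shows "\<exists>v. generates_preimage M L v"
proof -
  interpret group "Zmod_vec M :: ('n \<Rightarrow> int) monoid" by (rule group_Zmod_vec)
  have "\<exists>v. {x. reduce_vec M x \<in> L} = range (\<lambda>c :: 'n \<Rightarrow> int. \<Sum>j\<in>UNIV. c j *s v j)"
    (is "\<exists>v. ?P v")
    by (rule int_subgroup_basis)
      (simp_all add: reduce_vec_zero reduce_vec_diff[OF assms(1)] subgroup.one_closed[OF assms(2)]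
        subgroup.m_closed[OF assms(2)] subgroup.m_inv_closed[OF assms(2)])
  then obtain v where "?P v" ..
  then have "generates_preimage M L v"
    unfolding generates_preimage_def by (rule sym)
  then show ?thesis by blast
qed

text \<open>Equality of classes means that the difference lies in the lattice generated by
  \<open>v\<close>. Thus covering gives surjectivity and uniqueness gives injectivity.\<close>

lemma discrete_parallelepiped_bij_betw:
  fixes L :: "('n::finite \<Rightarrow> int) set"
  assumes "M > 0" "subgroup L (Zmod_vec M)" "generates_preimage M L v"
  shows "bij_betw (coset_class M L) (discrete_parallelepiped v) (carrier (Zmod_vec M Mod L))"
proof -
  have pre: "x \<in> range (\<lambda>c :: 'n \<Rightarrow> int. \<Sum>j\<in>UNIV. c j *s v j) \<longleftrightarrow> reduce_vec M x \<in> L" for x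
    using assms(3) unfolding generates_preimage_def by blast
  \<comment> \<open>Multiples of \<open>M\<close> reduce to the identity, which lies in
    \<open>L\<close>; this is what gives the lattice full rank.\<close>
  have "reduce_vec M (int M *s x) = \<one>\<^bsub>Zmod_vec M\<^esub>" for x :: "int ^ 'n"
    unfolding reduce_vec_zero[symmetric] by (simp add: reduce_vec_def)
  then have "int M *s x \<in> range (\<lambda>c :: 'n \<Rightarrow> int. \<Sum>j\<in>UNIV. c j *s v j)" for x
    unfolding pre using subgroup.one_closed[OF assms(2)] by metis
  then have bij: "bij (\<lambda>t :: real ^ 'n. \<Sum>j\<in>UNIV. t $ j *\<^sub>R int_vec_to_real (v j))"
    using assms(1) by (intro full_rank_lattice_coordinates[of "int M"]) auto
  note eq = coset_class_eq_iff[OF assms(1,2), folded pre]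
  show ?thesis
    unfolding bij_betw_def
  proof
    show "inj_on (coset_class M L) (discrete_parallelepiped v)"
      using discrete_parallelepiped_unique[OF bij] by (intro inj_onI) (simp add: eq)
    have "coset_class M L x \<in> coset_class M L ` discrete_parallelepiped v" for x
      using discrete_parallelepiped_covers[OF bij, of x] unfolding eq[symmetric] by (metis imageI)
    then show "coset_class M L ` discrete_parallelepiped v = carrier (Zmod_vec M Mod L)"
      unfolding coset_class_surj[OF assms(1), symmetric] by (intro equalityI) auto
  qed
qed

section \<open>The lattice of homogeneous solutions and the theorem\<close>

text \<open>\<open>L\<close> is the kernel of the homomorphism \<open>h\<close> induced by
  \<open>A\<close> into the product \<open>K\<close> of the groups of integers modulo
  \<open>m $ i\<close>. Solvability for every right-hand side makes \<open>h\<close> surjective, so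
  the quotient has as many elements as \<open>K\<close>.\<close>

lemma homogeneous_solution_lattice:
  fixes A :: "int ^ 'n ^ 'n" and m :: "int ^ 'n" and M :: nat
  assumes m_pos: "\<And>i. m $ i > 0"
    and M_eq: "M = nat (\<Prod>i\<in>UNIV. m $ i)"
    and solvable: "\<And>b. \<exists>x. solves_mod A b m x"
  obtains L where "subgroup L (Zmod_vec M)" "card (carrier (Zmod_vec M Mod L)) = M"
    "\<And>x. reduce_vec M x \<in> L \<longleftrightarrow> solves_mod A 0 m x"
proof -
  define K where "K = product_group UNIV (\<lambda>i. integer_mod_group (nat (m $ i)))"
  define h where "h = (\<lambda>r :: 'n \<Rightarrow> int. \<lambda>i. (A *v (\<chi> j. r j)) $ i mod m $ i)"
  let ?G = "Zmod_vec M :: ('n \<Rightarrow> int) monoid"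
  have m_nonneg: "m $ i \<ge> 0" for i
    using m_pos[of i] by simp
  have int_M: "int M = (\<Prod>i\<in>UNIV. m $ i)"
    unfolding M_eq by (simp add: prod_nonneg m_nonneg)
  have "0 < (\<Prod>i\<in>UNIV. m $ i)"
    using m_pos by (intro prod_pos) auto
  then have M_pos: "M > 0" using int_M by linarith
  have dvd: "m $ i dvd int M" for i
    unfolding int_M by (rule dvd_prodI) auto
  have carrier_K: "carrier K = (\<Pi>\<^sub>E i\<in>UNIV. {0..<m $ i})"
    by (simp add: K_def carrier_integer_mod_group m_nonneg not_le[THEN iffD2, OF m_pos])
  \<comment> \<open>Each \<open>m $ i\<close> divides \<open>M\<close>, so reducing the unknowns
    modulo \<open>M\<close> leaves row \<open>i\<close> unchanged modulo \<open>m $ i\<close>.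
    Properties of \<open>h\<close> can therefore be checked on integer vectors, where
    \<open>A\<close> acts additively.\<close>
  have h_reduce: "h (reduce_vec M x) = (\<lambda>i. (A *v x) $ i mod m $ i)" for x
  proof -
    have "[(\<Sum>j\<in>UNIV. A $ i $ j * (x $ j mod int M)) = (\<Sum>j\<in>UNIV. A $ i $ j * x $ j)] (mod m $ i)"
      for i
      by (intro cong_sum cong_mult cong_refl) (simp add: cong_def mod_mod_cancel[OF dvd])
    then show ?thesis
      by (simp add: h_def reduce_vec_def matrix_vector_mult_def cong_def)
  qed
  have reduce_cases: "\<exists>x. r = reduce_vec M x" if "r \<in> carrier ?G" for r
    using reduce_vec_surj[OF M_pos that] by metis
  have "h \<in> hom ?G K"
  proof (rule homI)
    fix r assume "r \<in> carrier ?G"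
    then show "h r \<in> carrier K" using m_pos by (simp add: carrier_K h_def PiE_iff)
  next
    fix r s assume "r \<in> carrier ?G" "s \<in> carrier ?G"
    then obtain x y where "r = reduce_vec M x" "s = reduce_vec M y"
      using reduce_cases by metis
    then show "h (r \<otimes>\<^bsub>?G\<^esub> s) = h r \<otimes>\<^bsub>K\<^esub> h s"
      by (simp add: h_reduce K_def matrix_vector_right_distrib mod_add_eq m_nonneg restrict_UNIV
          flip: reduce_vec_add)
  qed
  then interpret h: group_hom ?G K h
    by (simp add: group_hom_def group_hom_axioms_def group_Zmod_vec K_def)
  have surj: "h ` carrier ?G = carrier K"
  proof
    show "carrier K \<subseteq> h ` carrier ?G"
    proof
      fix k assume k: "k \<in> carrier K"
      \<comment> \<open>The element \<open>k\<close> itself is the right-hand side; its entries are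
        already reduced, so the congruences become equalities.\<close>
      obtain x where "solves_mod A (\<chi> i. k i) m x" using solvable by blast
      then have "h (reduce_vec M x) = k"
        using k by (auto simp: h_reduce solves_mod_def cong_def carrier_K PiE_iff)
      then show "k \<in> h ` carrier ?G" using reduce_vec_in_carrier[OF M_pos] by blast
    qed
  qed (use h.hom_closed in blast)
  have "card (carrier (?G Mod kernel ?G K h)) = card (carrier K)"
    using h.FactGroup_iso_set[OF surj] by (auto simp: iso_def dest: bij_betw_same_card)
  moreover have "int (card (carrier K)) = int M"
    by (simp add: carrier_K card_PiE int_M m_nonneg)
  ultimately have card: "card (carrier (?G Mod kernel ?G K h)) = M"
    by simp
  have "reduce_vec M x \<in> kernel ?G K h \<longleftrightarrow> solves_mod A 0 m x" for x
    by (simp add: kernel_def reduce_vec_in_carrier[OF M_pos] h_reduce solves_mod_def cong_def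
        K_def fun_eq_iff)
  then show thesis using that h.subgroup_kernel card by blast
qed

text \<open>One lattice \<open>L\<close> works for all \<open>b\<close>, and the solutions for a
  given \<open>b\<close> include a whole coset. Generators are shown to exist separately, so the
  claims about every generating family \<open>v\<close> are not vacuous.\<close>

theorem theorem1p1:
  fixes A :: "int ^ 'n ^ 'n" and m :: "int ^ 'n" and M :: nat
  assumes m_gt_1: "\<And>i. m $ i > 1"
    and M_eq: "M = nat (\<Prod>i\<in>UNIV. m $ i)"
    and pairwise_coprime: "\<And>i j. i \<noteq> j \<Longrightarrow> coprime (m $ i) (m $ j)"
    and row_coprime: "\<And>i. \<exists>j. coprime (A $ i $ j) (m $ i)"
  shows "(\<forall>b :: int ^ 'n. \<exists>x :: int ^ 'n. solves_mod A b m x) \<and>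
    (\<exists>L. subgroup L (Zmod_vec M :: ('n \<Rightarrow> int) monoid) \<and>
      card (carrier (Zmod_vec M Mod L)) = M \<and>
      (\<forall>b. \<exists>X \<in> carrier (Zmod_vec M Mod L). \<forall>x. coset_class M L x = X \<longrightarrow> solves_mod A b m x) \<and>
      (\<exists>v. generates_preimage M L v) \<and>
      (\<forall>v. generates_preimage M L v \<longrightarrow>
        bij_betw (coset_class M L) (discrete_parallelepiped v) (carrier (Zmod_vec M Mod L)) \<and>
        card (discrete_parallelepiped v) = M \<and>
        (\<forall>b. \<exists>x \<in> discrete_parallelepiped v. solves_mod A b m x)))"
proof -
  have m_pos: "m $ i > 0" for i
    using m_gt_1[of i] by simp
  have "0 < (\<Prod>i\<in>UNIV. m $ i)"
    using m_pos by (intro prod_pos) auto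
  then have M_pos: "M > 0"
    unfolding M_eq by simp
  have solvable: "\<exists>x. solves_mod A b m x" for b
    using solves_mod_exists pairwise_coprime row_coprime by blast
  obtain L where L: "subgroup L (Zmod_vec M)" "card (carrier (Zmod_vec M Mod L)) = M"
    and L_iff: "\<And>x. reduce_vec M x \<in> L \<longleftrightarrow> solves_mod A 0 m x"
    using homogeneous_solution_lattice[OF m_pos M_eq solvable] by blast
  have coset: "\<exists>X \<in> carrier (Zmod_vec M Mod L). \<forall>x. coset_class M L x = X \<longrightarrow> solves_mod A b m x"
    for b
  proof -
    \<comment> \<open>\<open>X\<close> is the coset of an arbitrary solution \<open>y\<close>: its
      members differ from \<open>y\<close> by solutions of the homogeneous system.\<close>
    obtain y where y: "solves_mod A b m y" using solvable by blast
    have "solves_mod A b m x" if "coset_class M L x = coset_class M L y" for x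
    proof -
      have "solves_mod A 0 m (x - y)"
        using that L_iff coset_class_eq_iff[OF M_pos L(1)] by blast
      then have "[(A *v x) $ i = (A *v y) $ i] (mod m $ i)" for i
        by (simp add: solves_mod_def matrix_vector_mult_diff_distrib cong_iff_dvd_diff)
      then show ?thesis using y cong_trans unfolding solves_mod_def by blast
    qed
    then show ?thesis using coset_class_surj[OF M_pos, of L] by blast
  qed
  have bij: "bij_betw (coset_class M L) (discrete_parallelepiped v) (carrier (Zmod_vec M Mod L))"
    if "generates_preimage M L v" for v
    using discrete_parallelepiped_bij_betw[OF M_pos L(1) that] .
  have "card (discrete_parallelepiped v) = M" if "generates_preimage M L v" for v
    using bij_betw_same_card[OF bij[OF that]] L(2) by simp
  moreover have "\<exists>x \<in> discrete_parallelepiped v. solves_mod A b m x"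
    if "generates_preimage M L v" for v b
    \<comment> \<open>Since the bijection is onto, the coset \<open>X\<close> has a representative
      in the parallelepiped.\<close>
    using coset[of b] unfolding bij_betw_imp_surj_on[OF bij[OF that], symmetric] by blast
  ultimately show ?thesis
    using solvable L coset bij generates_preimage_exists[OF M_pos L(1)]
    by (intro conjI exI[of _ L] allI impI)
qed

end
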